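(* Let $p\in(1,\infty)$. For every $k \in (0,1)$, $$K_p'(k)E_p(k)+K_p(k)E_p'(k)-K_p(k)K_p'(k)=\frac{\pi_p}{2},$$ where $k':=(1-k^p)^{1/p}$, $K_p'(k):=K_p(k')$ and $E_p'(k):=E_p(k')$ (primes do not denote derivatives).
   Context: For $p\in(1,\infty)$, let $\pi_p:=2\int_0^1\frac{dt}{(1-t^p)^{1/p}}=\frac{2\pi}{p\sin(\pi/p)}$. The function $\sin_p:[0,\pi_p/2]\to[0,1]$ is the inverse function of $x\mapsto\int_0^x \frac{dt}{(1-t^p)^{1/p}}$, $0\le x\le 1$. For $k\in[0,1)$ the complete $p$-elliptic integrals of the first and second kind are $$K_p(k):=\int_0^{\pi_p/2} \frac{d\theta}{(1-k^p\sin_p^p\theta)^{1-1/p}}=\int_0^1 \frac{dt}{(1-t^p)^{1/p}(1-k^pt^p)^{1-1/p}},$$ $$E_p(k):=\int_0^{\pi_p/2} (1-k^p\sin_p^p\theta)^{1/p}\,d\theta=\int_0^1 \left(\frac{1-k^pt^p}{1-t^p}\right)^{1/p}\,dt.$$ *)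

theory Defs
  imports "HOL-Analysis.Analysis"
begin

text \<open>
  All bases of \<open>powr\<close> below are nonnegative on the ranges of integration, and \<open>0 powr a = 0\<close>
  agrees with the usual power for the positive exponents used. The integrand of \<open>arcsin_p\<close> is
  singular at \<open>t = 1\<close>, where it takes the junk value \<open>1 / 0 = 0\<close>; a single point does not affect
  the integral.
\<close>

definition arcsin_p :: "real \<Rightarrow> real \<Rightarrow> real" where
  "arcsin_p p x = integral {0..x} (\<lambda>t. 1 / (1 - t powr p) powr (1 / p))"

definition pi_p :: "real \<Rightarrow> real" where
  "pi_p p = 2 * integral {0..1} (\<lambda>t. 1 / (1 - t powr p) powr (1 / p))"

text \<open>Only meaningful for arguments in \<open>{0..pi_p p / 2}\<close>, the image of \<open>{0..1}\<close> under \<open>arcsin_p p\<close>.\<close>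

definition sin_p :: "real \<Rightarrow> real \<Rightarrow> real" where
  "sin_p p = inv_into {0..1} (arcsin_p p)"

definition K_p :: "real \<Rightarrow> real \<Rightarrow> real" where
  "K_p p k = integral {0..pi_p p / 2}
     (\<lambda>\<theta>. 1 / (1 - k powr p * sin_p p \<theta> powr p) powr (1 - 1 / p))"

definition E_p :: "real \<Rightarrow> real \<Rightarrow> real" where
  "E_p p k = integral {0..pi_p p / 2}
     (\<lambda>\<theta>. (1 - k powr p * sin_p p \<theta> powr p) powr (1 / p))"

definition compl_modulus :: "real \<Rightarrow> real \<Rightarrow> real" where
  "compl_modulus p k = (1 - k powr p) powr (1 / p)"

definition K_p' :: "real \<Rightarrow> real \<Rightarrow> real" where
  "K_p' p k = K_p p (compl_modulus p k)"

definition E_p' :: "real \<Rightarrow> real \<Rightarrow> real" where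
  "E_p' p k = E_p p (compl_modulus p k)"

end

theory Submission
  imports Defs
begin

text \<open>
  In the variable \<open>m = k\<^sup>p\<close> the integrals satisfy \<open>dE/dm = (E - K) / (p m)\<close> and
  \<open>dK/dm = (E - (1 - m) K) / (p m (1 - m))\<close>, so the left-hand side of the Legendre relation is
  constant on \<open>(0, 1)\<close>. As \<open>m \<rightarrow> 0\<close> it tends to \<open>K(0) E(1) = \<pi>\<^sub>p / 2\<close>, since \<open>E - K = O(m)\<close>
  whereas \<open>K(1 - m) = O(m\<^bsup>1/p - 1\<^esup>)\<close>.
\<close>

context
  fixes p :: real
  assumes p: "1 < p"
begin

section \<open>The arcsine integral and its inverse \<open>sin_p\<close>\<close>

lemma powr_le_base: "t powr p \<le> t" if "0 \<le> t" "t \<le> 1" for t :: real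
  using powr_mono'[of 1 p t] p that by simp

lemma powr_less_one: "t powr p < 1" if "0 \<le> t" "t < 1" for t :: real
  using powr_le_base[of t] that by simp

text \<open>Domination: \<open>t powr p \<le> t\<close> bounds the integrand by
  \<open>(1 - t) powr (- 1 / p)\<close>. As \<open>p > 1\<close>, this has an antiderivative that is
  continuous up to \<open>t = 1\<close>, so it is integrable.\<close>

lemma arcsin_p_integrable:
  "(\<lambda>t. 1 / (1 - t powr p) powr (1 / p)) integrable_on {0..1}"
proof (rule measurable_bounded_by_integrable_imp_integrable_real)
  let ?a = "1 - 1 / p"
  have a: "?a > 0" using p by simp
  show "(\<lambda>t. 1 / (1 - t powr p) powr (1 / p)) \<in> borel_measurable (lebesgue_on {0..1})"
    by (intro measurable_restrict_space1 measurable_completion) measurable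
  have "((\<lambda>t. (1 - t) powr (- 1 / p)) has_integral
      (- ((1 - 1) powr ?a / ?a)) - (- ((1 - 0) powr ?a / ?a))) {0..1}"
  proof (rule fundamental_theorem_of_calculus_interior)
    show "continuous_on {0..1} (\<lambda>t. - ((1 - t) powr ?a / ?a))"
      using a by (intro continuous_intros continuous_on_powr') auto
    show "((\<lambda>t. - ((1 - t) powr ?a / ?a)) has_vector_derivative (1 - x) powr (- 1 / p)) (at x)"
      if "x \<in> {0<..<1}" for x
      unfolding has_real_derivative_iff_has_vector_derivative[symmetric]
      using that a by (auto intro!: derivative_eq_intros)
  qed simp
  then show "(\<lambda>t. (1 - t) powr (- 1 / p)) integrable_on {0..1}"
    by blast
  show "\<bar>1 / (1 - t powr p) powr (1 / p)\<bar> \<le> (1 - t) powr (- 1 / p)" if "t \<in> {0..1}" for t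
  \<comment> \<open>At \<open>t = 1\<close> both sides are 0, by the conventions
    \<open>1 / 0 = 0\<close> and \<open>0 powr a = 0\<close>.\<close>
  proof (cases "t = 1")
    case False
    then have "(1 - t) powr (1 / p) \<le> (1 - t powr p) powr (1 / p)"
      using that p powr_le_base[of t] by (intro powr_mono2) auto
    with False that show ?thesis
      by (simp add: powr_minus_divide frac_le)
  qed simp
qed simp

lemma continuous_on_arcsin_p: "continuous_on {0..1} (arcsin_p p)"
  unfolding arcsin_p_def
  by (rule indefinite_integral_continuous_1[OF arcsin_p_integrable])

lemma arcsin_p_has_real_derivative:
  assumes "0 < x" "x < 1"
  shows "(arcsin_p p has_real_derivative 1 / (1 - x powr p) powr (1 / p)) (at x)"
proof -
  \<comment> \<open>Stopping at \<open>b\<close> avoids the singularity at 1: the integrand is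
    continuous on \<open>{0..b}\<close>, and \<open>x\<close> is an interior point of that
    interval.\<close>
  obtain b where b: "x < b" "b < 1" using assms dense by blast
  have "1 - t powr p \<noteq> 0" if "t \<in> {0..b}" for t
    using powr_less_one[of t] that b by auto
  then have "continuous_on {0..b} (\<lambda>t. 1 / (1 - t powr p) powr (1 / p))"
    using p by (intro continuous_intros continuous_on_powr') auto
  from integral_has_real_derivative[OF this, of x] show ?thesis
    using assms b unfolding arcsin_p_def
    by (simp add: at_within_Icc_at)
qed

text \<open>A positive derivative on the open interval suffices, together with continuity up to the
  ends. Strictness gives the injectivity on which the inverse \<open>sin_p\<close> rests.\<close>

lemma arcsin_p_less:
  assumes "0 \<le> x" "x < y" "y \<le> 1"
  shows "arcsin_p p x < arcsin_p p y"
proof (rule DERIV_pos_imp_increasing_open[OF \<open>x < y\<close>])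
  show "\<exists>d. (arcsin_p p has_real_derivative d) (at t) \<and> 0 < d" if "x < t" "t < y" for t
    using arcsin_p_has_real_derivative[of t] powr_less_one[of t] that assms
    by (intro exI[of _ "1 / (1 - t powr p) powr (1 / p)"]) auto
  show "continuous_on {x..y} (arcsin_p p)"
    using continuous_on_subset[OF continuous_on_arcsin_p] assms by auto
qed

lemma arcsin_p_0: "arcsin_p p 0 = 0"
  by (simp add: arcsin_p_def)

lemma arcsin_p_1: "arcsin_p p 1 = pi_p p / 2"
  by (simp add: arcsin_p_def pi_p_def)

lemma pi_p_pos: "pi_p p > 0"
  using arcsin_p_less[of 0 1] by (simp add: arcsin_p_0 arcsin_p_1)

lemma inj_on_arcsin_p: "inj_on (arcsin_p p) {0..1}"
  using arcsin_p_less by (intro linorder_inj_onI) (auto simp: less_le)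

text \<open>Monotonicity gives one inclusion and the intermediate value theorem the other. With
  injectivity this makes \<open>sin_p\<close> a genuine two-sided inverse.\<close>

lemma arcsin_p_image: "arcsin_p p ` {0..1} = {0..pi_p p / 2}"
proof (intro equalityI subsetI)
  fix y assume "y \<in> arcsin_p p ` {0..1}"
  then obtain x where x: "0 \<le> x" "x \<le> 1" "y = arcsin_p p x" by auto
  then show "y \<in> {0..pi_p p / 2}"
    using arcsin_p_less[of 0 x] arcsin_p_less[of x 1] pi_p_pos
    by (cases "x = 0"; cases "x = 1") (auto simp: arcsin_p_0 arcsin_p_1)
next
  fix y assume "y \<in> {0..pi_p p / 2}"
  then show "y \<in> arcsin_p p ` {0..1}"
    using IVT'[of "arcsin_p p" 0 y 1] continuous_on_arcsin_p
    by (auto simp: arcsin_p_0 arcsin_p_1)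
qed

lemma sin_p_arcsin_p: "sin_p p (arcsin_p p x) = x" if "0 \<le> x" "x \<le> 1"
  using that inj_on_arcsin_p by (simp add: sin_p_def)

lemma arcsin_p_sin_p: "arcsin_p p (sin_p p \<theta>) = \<theta>" if "\<theta> \<in> {0..pi_p p / 2}"
  using that unfolding sin_p_def by (simp add: f_inv_into_f arcsin_p_image)

lemma sin_p_range: "sin_p p \<theta> \<in> {0..1}" if "\<theta> \<in> {0..pi_p p / 2}"
  using that unfolding sin_p_def by (intro inv_into_into) (simp add: arcsin_p_image)

lemma sin_p_0: "sin_p p 0 = 0"
  using sin_p_arcsin_p[of 0] by (simp add: arcsin_p_0)

lemma sin_p_half_pi: "sin_p p (pi_p p / 2) = 1"
  using sin_p_arcsin_p[of 1] by (simp add: arcsin_p_1)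

lemma sin_p_interior:
  assumes "0 < \<theta>" "\<theta> < pi_p p / 2"
  shows "0 < sin_p p \<theta>" "sin_p p \<theta> < 1"
proof -
  have "sin_p p \<theta> \<in> {0..1}" "arcsin_p p (sin_p p \<theta>) = \<theta>"
    using assms sin_p_range arcsin_p_sin_p by auto
  moreover from this have "sin_p p \<theta> \<noteq> 0" "sin_p p \<theta> \<noteq> 1"
    using assms arcsin_p_0 arcsin_p_1 by auto
  ultimately show "0 < sin_p p \<theta>" "sin_p p \<theta> < 1" by auto
qed

text \<open>The inverse of a continuous injection on a compact set is continuous.\<close>

lemma continuous_on_sin_p: "continuous_on {0..pi_p p / 2} (sin_p p)"
  using continuous_on_inv[OF continuous_on_arcsin_p, of "sin_p p"] sin_p_arcsin_p
  by (simp add: arcsin_p_image)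

text \<open>Inverse function rule; the value is the \<open>p\<close>-analogue of the cosine.\<close>

lemma sin_p_has_real_derivative:
  assumes "0 < \<theta>" "\<theta> < pi_p p / 2"
  shows "(sin_p p has_real_derivative (1 - sin_p p \<theta> powr p) powr (1 / p)) (at \<theta>)"
proof -
  note s = sin_p_interior[OF assms]
  have "isCont (sin_p p) \<theta>"
    using continuous_on_interior[OF continuous_on_sin_p] assms by simp
  then have "(sin_p p has_real_derivative
      inverse (1 / (1 - sin_p p \<theta> powr p) powr (1 / p))) (at \<theta>)"
    using s assms powr_less_one[of "sin_p p \<theta>"] arcsin_p_sin_p
    by (intro DERIV_inverse_function[where f = "arcsin_p p" and a = 0 and b = "pi_p p / 2"]
        arcsin_p_has_real_derivative) auto
  then show ?thesis by simp
qed

lemma sin_p_powr_range: "0 \<le> sin_p p \<theta> powr p" "sin_p p \<theta> powr p \<le> 1"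
  if "\<theta> \<in> {0..pi_p p / 2}"
  using sin_p_range[OF that] p by (auto intro: powr_le1)

lemma continuous_on_sin_p_powr: "continuous_on {0..pi_p p / 2} (\<lambda>\<theta>. sin_p p \<theta> powr p)"
  using continuous_on_sin_p sin_p_range p by (intro continuous_on_powr') auto

text \<open>Since \<open>m < 1\<close>, the base stays positive even where \<open>sin_p\<close>
  reaches 1, so negative exponents cause no singularity.\<close>

lemma modulus_sin_p_pos: "0 < 1 - m * sin_p p \<theta> powr p"
  if "0 \<le> m" "m < 1" "\<theta> \<in> {0..pi_p p / 2}"
proof -
  have "m * sin_p p \<theta> powr p \<le> m * 1"
    using that sin_p_powr_range by (intro mult_left_mono) auto
  with that show ?thesis by simp
qed

section \<open>Both kinds of integrals as functions of \<open>m = k powr p\<close>\<close>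

text \<open>A single family: \<open>a = 1 / p\<close> gives the second kind and
  \<open>a = 1 / p - 1\<close> the first, so continuity and differentiation are treated once. In the
  variable \<open>m\<close> the complementary modulus becomes \<open>1 - m\<close>.\<close>

definition elliptic :: "real \<Rightarrow> real \<Rightarrow> real" where
  "elliptic a m = integral {0..pi_p p / 2} (\<lambda>\<theta>. (1 - m * sin_p p \<theta> powr p) powr a)"

lemma E_p_eq: "E_p p k = elliptic (1 / p) (k powr p)"
  by (simp add: E_p_def elliptic_def)

lemma K_p_eq: "K_p p k = elliptic (1 / p - 1) (k powr p)"
proof -
  have "1 / x powr (1 - 1 / p) = x powr (1 / p - 1)" for x :: real
    using powr_minus_divide[of x "1 - 1 / p"] by simp
  then show ?thesis by (simp add: K_p_def elliptic_def)
qed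

lemma elliptic_0: "elliptic a 0 = pi_p p / 2"
  using pi_p_pos by (simp add: elliptic_def)

lemma elliptic_integrand_continuous:
  assumes "0 \<le> m" "m < 1"
  shows "continuous_on {0..pi_p p / 2} (\<lambda>\<theta>. (1 - m * sin_p p \<theta> powr p) powr a)"
proof -
  have "\<forall>\<theta>\<in>{0..pi_p p / 2}. 1 - m * sin_p p \<theta> powr p \<noteq> 0"
    using modulus_sin_p_pos[OF assms] less_irrefl by metis
  then show ?thesis
    by (intro continuous_on_powr continuous_on_diff continuous_on_mult continuous_on_const
        continuous_on_sin_p_powr)
qed

lemma continuous_on_snd_sin_p:
  "continuous_on (U \<times> {0..pi_p p / 2}) (\<lambda>z. sin_p p (snd z) powr p)"
  by (rule continuous_on_compose2[OF continuous_on_sin_p_powr, of _ snd])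
    (auto intro: continuous_on_snd continuous_on_id)

section \<open>Derivatives with respect to \<open>m\<close>\<close>

text \<open>Leibniz rule over the open parameter interval \<open>{0<..<1}\<close>. There the base is
  positive, so the derivative in \<open>m\<close> is jointly continuous for every real
  \<open>a\<close>; openness turns the derivative within the interval into a full one.\<close>

lemma elliptic_has_real_derivative:
  assumes "0 < m" "m < 1"
  shows "(elliptic a has_real_derivative
    integral {0..pi_p p / 2}
      (\<lambda>\<theta>. - a * sin_p p \<theta> powr p * (1 - m * sin_p p \<theta> powr p) powr (a - 1))) (at m)"
proof -
  let ?U = "{0<..<1 :: real}" and ?f = "\<lambda>m \<theta>. (1 - m * sin_p p \<theta> powr p) powr a"
  let ?f' = "\<lambda>m \<theta>. - a * sin_p p \<theta> powr p * (1 - m * sin_p p \<theta> powr p) powr (a - 1)"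
  have "((\<lambda>m. integral (cbox 0 (pi_p p / 2)) (?f m)) has_real_derivative
      integral (cbox 0 (pi_p p / 2)) (?f' m)) (at m within ?U)"
  proof (rule leibniz_rule_field_derivative)
    show "((\<lambda>m. ?f m \<theta>) has_real_derivative ?f' m \<theta>) (at m within ?U)"
      if "m \<in> ?U" "\<theta> \<in> cbox 0 (pi_p p / 2)" for m \<theta>
      using that modulus_sin_p_pos[of m \<theta>]
      by (auto intro!: derivative_eq_intros)
    show "?f m integrable_on cbox 0 (pi_p p / 2)" if "m \<in> ?U" for m
      using that elliptic_integrand_continuous[of m]
      by (auto intro!: integrable_continuous_interval)
    have "\<forall>z\<in>?U \<times> {0..pi_p p / 2}. 1 - fst z * sin_p p (snd z) powr p \<noteq> 0"
    proof
      fix z assume "z \<in> ?U \<times> {0..pi_p p / 2}"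
      then show "1 - fst z * sin_p p (snd z) powr p \<noteq> 0"
        using modulus_sin_p_pos[of "fst z" "snd z"] by auto
    qed
    then show "continuous_on (?U \<times> cbox 0 (pi_p p / 2)) (\<lambda>(m, \<theta>). ?f' m \<theta>)"
      unfolding split_beta box_real
      by (intro continuous_on_powr continuous_on_diff continuous_on_mult continuous_on_const
          continuous_on_fst continuous_on_id continuous_on_snd_sin_p)
  qed (use assms in auto)
  then show ?thesis
    using assms by (simp add: elliptic_def[abs_def] at_within_open[of m ?U])
qed

text \<open>"Second" refers to the kind of the integral, not to the order of the derivative. Writing
  \<open>D = 1 - m * u\<close> for the base, the identity \<open>m * u = 1 - D\<close> expresses the
  differentiated integrand through the powers belonging to E and K.\<close>

lemma elliptic_second_derivative:
  assumes m: "0 < m" "m < 1"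
  shows "(elliptic (1 / p) has_real_derivative
    (elliptic (1 / p) m - elliptic (1 / p - 1) m) / (p * m)) (at m)"
proof -
  let ?S = "{0..pi_p p / 2}" and ?u = "\<lambda>\<theta>. sin_p p \<theta> powr p"
  let ?D = "\<lambda>\<theta>. 1 - m * ?u \<theta>"
  have int: "(\<lambda>\<theta>. ?D \<theta> powr a) integrable_on ?S" for a
    using m by (intro integrable_continuous_interval elliptic_integrand_continuous) auto
  have "integral ?S (\<lambda>\<theta>. - (1 / p) * ?u \<theta> * ?D \<theta> powr (1 / p - 1)) =
      integral ?S (\<lambda>\<theta>. (?D \<theta> powr (1 / p) - ?D \<theta> powr (1 / p - 1)) / (p * m))"
  proof (rule integral_cong)
    fix \<theta> assume "\<theta> \<in> ?S"
    then have "?D \<theta> > 0" using m modulus_sin_p_pos by auto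
    then have *: "?D \<theta> powr (1 / p) = ?D \<theta> * ?D \<theta> powr (1 / p - 1)"
      using powr_mult_base[of "?D \<theta>" "1 / p - 1"] by simp
    show "- (1 / p) * ?u \<theta> * ?D \<theta> powr (1 / p - 1) =
        (?D \<theta> powr (1 / p) - ?D \<theta> powr (1 / p - 1)) / (p * m)"
      unfolding * using m p by (simp add: field_simps)
  qed
  also have "\<dots> = (elliptic (1 / p) m - elliptic (1 / p - 1) m) / (p * m)"
    by (simp add: elliptic_def integral_diff int)
  finally show ?thesis
    using elliptic_has_real_derivative[OF m, of "1 / p"] by simp
qed

text \<open>
  This function vanishes at both ends of \<open>[0, \<pi>\<^sub>p / 2]\<close>; integrating its derivative expresses the
  integral arising in \<open>dK/dm\<close> through \<open>E\<close> and \<open>K\<close>.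
\<close>

lemma elliptic_boundary_term_derivative:
  assumes m: "0 < m" "m < 1" and \<theta>: "0 < \<theta>" "\<theta> < pi_p p / 2"
  defines "u \<equiv> \<lambda>\<theta>. sin_p p \<theta> powr p"
  shows "((\<lambda>\<theta>. sin_p p \<theta> * (1 - u \<theta>) powr (1 - 1 / p) * (1 - m * u \<theta>) powr (1 / p - 1))
    has_real_derivative
      (1 - m * u \<theta>) powr (1 / p) / m - (1 - m) / m * (1 - m * u \<theta>) powr (1 / p - 1)
      - (p - 1) * (1 - m) * (u \<theta> * (1 - m * u \<theta>) powr (1 / p - 2))) (at \<theta>)"
proof -
  define s where "s = sin_p p \<theta>"
  have s: "0 < s" "s < 1" using sin_p_interior[OF \<theta>] by (auto simp: s_def)
  define U where "U = s powr p"
  have U: "0 < U" "U < 1" using powr_less_one[of s] s by (auto simp: U_def)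
  \<comment> \<open>\<open>c\<close> is the derivative of \<open>sin_p\<close>, \<open>d\<close> the
    base of the elliptic integrand, and \<open>v\<close> below the derivative of \<open>u\<close>.
    With \<open>X\<close> as the lowest power of \<open>d\<close> that occurs, the remaining powers
    of \<open>d\<close> are polynomial multiples of \<open>X\<close>.\<close>
  define c where "c = (1 - U) powr (1 / p)"
  define d where "d = 1 - m * U"
  have d: "d > 0" using m U mult_strict_mono[of m 1 U 1] by (simp add: d_def)
  define X where "X = d powr (1 / p - 2)"
  have X: "d powr (1 / p - 1) = d * X" "d powr (1 / p) = d * (d * X)"
    using powr_mult_base[of d "1 / p - 2"] powr_mult_base[of d "1 / p - 1"] d
    by (auto simp: X_def)
  have c: "c > 0" using U by (simp add: c_def)
  have C: "(1 - U) powr (1 - 1 / p) = (1 - U) / c" "(1 - U) powr (- 1 / p) = 1 / c"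
    using U by (auto simp: c_def powr_diff powr_minus_divide)
  have sU: "s * s powr (p - 1) = U"
    using powr_mult_base[of s "p - 1"] s by (simp add: U_def)
  define v where "v = p * s powr (p - 1) * c"
  have sv: "s * v = p * U * c" using sU by (simp add: v_def)
  have ds: "(sin_p p has_real_derivative c) (at \<theta>)"
    using sin_p_has_real_derivative[OF \<theta>] by (simp add: c_def U_def s_def)
  have du: "(u has_real_derivative v) (at \<theta>)"
    unfolding u_def v_def s_def using s
    by (auto intro!: derivative_eq_intros ds simp: s_def)
  have u: "u \<theta> = U" by (simp add: u_def U_def s_def)
  have d1: "((\<lambda>\<theta>. (1 - u \<theta>) powr (1 - 1 / p)) has_real_derivative
      (1 - 1 / p) * (1 / c) * - v) (at \<theta>)"
    using U by (auto intro!: derivative_eq_intros du simp: u C[simplified])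
  have d2: "((\<lambda>\<theta>. (1 - m * u \<theta>) powr (1 / p - 1)) has_real_derivative
      (1 / p - 1) * X * - (m * v)) (at \<theta>)"
    using d by (auto intro!: derivative_eq_intros du simp: u X_def d_def)
  have "((\<lambda>\<theta>. sin_p p \<theta> * (1 - u \<theta>) powr (1 - 1 / p) * (1 - m * u \<theta>) powr (1 / p - 1))
    has_real_derivative
      (c * ((1 - U) / c) + (1 - 1 / p) * (1 / c) * - v * s) * (d * X)
      + (1 / p - 1) * X * - (m * v) * (s * ((1 - U) / c))) (at \<theta>)"
    using DERIV_mult[OF DERIV_mult[OF ds d1] d2]
    by (simp add: u s_def[symmetric] C X d_def[symmetric])
  \<comment> \<open>After \<open>c\<close> cancels, two identities do the work:
    \<open>d * (1 - U) = d * d / m - (1 - m) / m * d\<close> and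
    \<open>d - m * (1 - U) = 1 - m\<close>.\<close>
  moreover have "(c * ((1 - U) / c) + (1 - 1 / p) * (1 / c) * - v * s) * (d * X)
      + (1 / p - 1) * X * - (m * v) * (s * ((1 - U) / c))
    = d * (d * X) / m - (1 - m) / m * (d * X) - (p - 1) * (1 - m) * (U * X)"
  proof -
    have e1: "(1 - 1 / p) * (1 / c) * - v * s = - (p - 1) * U"
    proof -
      have "(1 - 1 / p) * (1 / c) * - v * s = - ((1 - 1 / p) * (1 / c) * (s * v))"
        by (simp only: mult_minus_left mult_minus_right mult_ac)
      also have "\<dots> = - (p - 1) * U" unfolding sv using c p by (simp add: field_simps)
      finally show ?thesis .
    qed
    have e2: "(1 / p - 1) * X * - (m * v) * (s * ((1 - U) / c)) = (p - 1) * X * m * U * (1 - U)"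
    proof -
      have "(1 / p - 1) * X * - (m * v) * (s * ((1 - U) / c))
        = (1 - 1 / p) * X * m * ((1 - U) / c) * (s * v)" by (simp add: algebra_simps)
      also have "\<dots> = (p - 1) * X * m * U * (1 - U)"
        unfolding sv using c p by (simp add: field_simps)
      finally show ?thesis .
    qed
    have e3: "c * ((1 - U) / c) = 1 - U" using c by simp
    show ?thesis
      unfolding e1 e2 e3 d_def using m by (simp add: field_simps)
  qed
  ultimately show ?thesis
    by (simp add: u X d_def[symmetric] X_def[symmetric])
qed

text \<open>Differentiating under the integral produces \<open>(1 - 1 / p) * J\<close>, where
  \<open>J\<close> involves the exponent \<open>1 / p - 2\<close> and is neither E nor K. The
  vanishing integral of the derivative of \<open>?G\<close> is a linear relation that eliminates
  \<open>J\<close>.\<close>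

lemma elliptic_first_derivative:
  assumes m: "0 < m" "m < 1"
  shows "(elliptic (1 / p - 1) has_real_derivative
    (elliptic (1 / p) m - (1 - m) * elliptic (1 / p - 1) m) / (p * m * (1 - m))) (at m)"
proof -
  let ?S = "{0..pi_p p / 2}" and ?u = "\<lambda>\<theta>. sin_p p \<theta> powr p"
  let ?D = "\<lambda>\<theta>. 1 - m * ?u \<theta>"
  let ?G = "\<lambda>\<theta>. sin_p p \<theta> * (1 - ?u \<theta>) powr (1 - 1 / p) * ?D \<theta> powr (1 / p - 1)"
  define J where "J = integral ?S (\<lambda>\<theta>. ?u \<theta> * ?D \<theta> powr (1 / p - 2))"
  have intD: "((\<lambda>\<theta>. ?D \<theta> powr a) has_integral elliptic a m) ?S" for a
    unfolding elliptic_def using m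
    by (intro integrable_integral integrable_continuous_interval elliptic_integrand_continuous) auto
  have intJ: "((\<lambda>\<theta>. ?u \<theta> * ?D \<theta> powr (1 / p - 2)) has_integral J) ?S"
    unfolding J_def using m
    by (intro integrable_integral integrable_continuous_interval continuous_on_mult
        continuous_on_sin_p_powr elliptic_integrand_continuous) auto
  let ?G' = "\<lambda>\<theta>. ?D \<theta> powr (1 / p) / m - (1 - m) / m * ?D \<theta> powr (1 / p - 1)
      - (p - 1) * (1 - m) * (?u \<theta> * ?D \<theta> powr (1 / p - 2))"
  have G: "(?G' has_integral ?G (pi_p p / 2) - ?G 0) ?S"
  proof (rule fundamental_theorem_of_calculus_interior)
    have "continuous_on ?S (\<lambda>\<theta>. (1 - ?u \<theta>) powr (1 - 1 / p))"
      using p sin_p_powr_range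
      by (intro continuous_on_powr' continuous_intros continuous_on_sin_p_powr) auto
    then show "continuous_on ?S ?G"
      using m by (intro continuous_on_mult continuous_on_sin_p elliptic_integrand_continuous) auto
    show "(?G has_vector_derivative ?G' \<theta>) (at \<theta>)" if "\<theta> \<in> {0<..<pi_p p / 2}" for \<theta>
      unfolding has_real_derivative_iff_has_vector_derivative[symmetric]
      using elliptic_boundary_term_derivative[OF m, of \<theta>] that by simp
  qed (use pi_p_pos in auto)
  \<comment> \<open>The factor \<open>sin_p\<close> vanishes at the left end, and
    \<open>(1 - ?u \<theta>) powr (1 - 1 / p)\<close> at the right end, where its base is 0.\<close>
  have G0: "?G (pi_p p / 2) - ?G 0 = 0"
    by (simp add: sin_p_0 sin_p_half_pi)
  have "(?G' has_integral elliptic (1 / p) m / m - (1 - m) / m * elliptic (1 / p - 1) m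
      - (p - 1) * (1 - m) * J) ?S"
    by (intro has_integral_diff has_integral_mult_right has_integral_divide intD intJ)
  then have eq: "elliptic (1 / p) m / m - (1 - m) / m * elliptic (1 / p - 1) m
      - (p - 1) * (1 - m) * J = 0"
    by (rule has_integral_unique[OF _ G[unfolded G0]])
  have "integral ?S (\<lambda>\<theta>. - (1 / p - 1) * ?u \<theta> * ?D \<theta> powr (1 / p - 1 - 1)) = - (1 / p - 1) * J"
    using has_integral_mult_right[OF intJ, of "- (1 / p - 1)"]
    by (intro integral_unique) (simp add: mult.assoc)
  also have "\<dots> = (elliptic (1 / p) m - (1 - m) * elliptic (1 / p - 1) m) / (p * m * (1 - m))"
  proof -
    have "elliptic (1 / p) m - (1 - m) * elliptic (1 / p - 1) m = m * ((p - 1) * (1 - m) * J)"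
      using eq m by (simp add: field_simps)
    then have "(elliptic (1 / p) m - (1 - m) * elliptic (1 / p - 1) m) / (p * m * (1 - m)) =
        (p - 1) * J / p"
      using m p by simp
    also have "\<dots> = - (1 / p - 1) * J"
      using p by (simp add: field_simps)
    finally show ?thesis by simp
  qed
  finally show ?thesis
    using elliptic_has_real_derivative[OF m, of "1 / p - 1"] by simp
qed

section \<open>End values and growth bounds\<close>

text \<open>The exponent \<open>1 / p\<close> is positive, so the integrand is jointly continuous
  even where its base is 0. This makes the limits of E at both ends of the parameter range
  available.\<close>

lemma continuous_on_elliptic_second: "continuous_on {0..1} (elliptic (1 / p))"
proof -
  have "continuous_on {0..1}
      (\<lambda>m. integral (cbox 0 (pi_p p / 2)) (\<lambda>\<theta>. (1 - m * sin_p p \<theta> powr p) powr (1 / p)))"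
  proof (rule integral_continuous_on_param)
    have "0 \<le> 1 - m * sin_p p \<theta> powr p" if "m \<in> {0..1}" "\<theta> \<in> {0..pi_p p / 2}" for m \<theta>
      using that sin_p_powr_range[of \<theta>] mult_mono[of m 1 "sin_p p \<theta> powr p" 1] by simp
    then show "continuous_on ({0..1} \<times> cbox 0 (pi_p p / 2))
        (\<lambda>(m, \<theta>). (1 - m * sin_p p \<theta> powr p) powr (1 / p))"
      unfolding split_beta box_real using p
      by (intro continuous_on_powr' continuous_intros continuous_on_snd_sin_p) auto
  qed
  then show ?thesis by (simp add: elliptic_def[abs_def])
qed

text \<open>At \<open>m = 1\<close> the integrand is exactly the derivative of
  \<open>sin_p\<close>.\<close>

lemma elliptic_second_1: "elliptic (1 / p) 1 = 1"
proof -
  have "((\<lambda>\<theta>. (1 - sin_p p \<theta> powr p) powr (1 / p)) has_integral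
      sin_p p (pi_p p / 2) - sin_p p 0) {0..pi_p p / 2}"
    using pi_p_pos continuous_on_sin_p sin_p_has_real_derivative
    by (intro fundamental_theorem_of_calculus_interior)
      (auto simp: has_real_derivative_iff_has_vector_derivative[symmetric])
  then show ?thesis
    by (simp add: elliptic_def sin_p_0 sin_p_half_pi integral_unique)
qed

text \<open>The base is at least \<open>1 - m\<close> and the exponent is negative. Used at
  \<open>m\<close> for boundedness of K near 0, and at \<open>1 - m\<close> for its growth rate near
  1.\<close>

lemma elliptic_first_bounds:
  assumes m: "0 \<le> m" "m < 1"
  shows "0 \<le> elliptic (1 / p - 1) m"
    and "elliptic (1 / p - 1) m \<le> pi_p p / 2 * (1 - m) powr (1 / p - 1)"
proof -
  let ?S = "{0..pi_p p / 2}"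
  have int: "(\<lambda>\<theta>. (1 - m * sin_p p \<theta> powr p) powr (1 / p - 1)) integrable_on ?S"
    by (intro integrable_continuous_interval elliptic_integrand_continuous m)
  show "0 \<le> elliptic (1 / p - 1) m"
    unfolding elliptic_def by (intro integral_nonneg int) simp
  have "elliptic (1 / p - 1) m \<le> integral ?S (\<lambda>\<theta>. (1 - m) powr (1 / p - 1))"
    unfolding elliptic_def
  proof (intro integral_le int)
    fix \<theta> assume "\<theta> \<in> ?S"
    then have "1 - m \<le> 1 - m * sin_p p \<theta> powr p"
      using m sin_p_powr_range[of \<theta>] by (simp add: mult_left_le)
    then show "(1 - m * sin_p p \<theta> powr p) powr (1 / p - 1) \<le> (1 - m) powr (1 / p - 1)"
      using m p by (intro powr_mono2') auto
  qed (rule integrable_const_ivl)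
  then show "elliptic (1 / p - 1) m \<le> pi_p p / 2 * (1 - m) powr (1 / p - 1)"
    using pi_p_pos by simp
qed

text \<open>The E-integrand is the K-integrand times the base, which lies between
  \<open>1 - m\<close> and 1. The resulting factor \<open>m\<close> has to outweigh the growth of K
  at \<open>1 - m\<close>.\<close>

lemma elliptic_diff_bounds:
  assumes m: "0 \<le> m" "m < 1"
  shows "elliptic (1 / p) m \<le> elliptic (1 / p - 1) m"
    and "elliptic (1 / p - 1) m - elliptic (1 / p) m \<le> m * elliptic (1 / p - 1) m"
proof -
  let ?S = "{0..pi_p p / 2}"
  let ?D = "\<lambda>\<theta>. 1 - m * sin_p p \<theta> powr p"
  have int: "(\<lambda>\<theta>. ?D \<theta> powr a) integrable_on ?S" for a
    by (intro integrable_continuous_interval elliptic_integrand_continuous m)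
  have *: "?D \<theta> powr (1 / p) = ?D \<theta> * ?D \<theta> powr (1 / p - 1)"
      "1 - m \<le> ?D \<theta>" "?D \<theta> \<le> 1" if "\<theta> \<in> ?S" for \<theta>
    using powr_mult_base[of "?D \<theta>" "1 / p - 1"] modulus_sin_p_pos[OF m that] m
      sin_p_powr_range[OF that] by (auto simp: mult_left_le)
  show "elliptic (1 / p) m \<le> elliptic (1 / p - 1) m"
    unfolding elliptic_def
  proof (intro integral_le int)
    fix \<theta> assume "\<theta> \<in> ?S"
    from * [OF this] show "?D \<theta> powr (1 / p) \<le> ?D \<theta> powr (1 / p - 1)"
      using m mult_right_mono[of "?D \<theta>" 1 "?D \<theta> powr (1 / p - 1)"] by simp
  qed
  have "integral ?S (\<lambda>\<theta>. (1 - m) * ?D \<theta> powr (1 / p - 1)) \<le> elliptic (1 / p) m"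
    unfolding elliptic_def
  proof (intro integral_le int integrable_on_mult_right)
    fix \<theta> assume "\<theta> \<in> ?S"
    from * [OF this] show "(1 - m) * ?D \<theta> powr (1 / p - 1) \<le> ?D \<theta> powr (1 / p)"
      by (simp only: mult_right_mono powr_ge_zero)
  qed
  then show "elliptic (1 / p - 1) m - elliptic (1 / p) m \<le> m * elliptic (1 / p - 1) m"
    by (simp only: elliptic_def[symmetric] integral_mult_right) (simp add: algebra_simps)
qed

section \<open>Constancy of the Legendre combination and its value\<close>

definition legendre :: "real \<Rightarrow> real" where
  "legendre m = elliptic (1 / p - 1) (1 - m) * elliptic (1 / p) m
    + elliptic (1 / p - 1) m * elliptic (1 / p) (1 - m)
    - elliptic (1 / p - 1) m * elliptic (1 / p - 1) (1 - m)"

lemma legendre_has_derivative_0: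
  assumes m: "0 < m" "m < 1"
  shows "(legendre has_real_derivative 0) (at m)"
proof -
  let ?K = "elliptic (1 / p - 1)" and ?E = "elliptic (1 / p)"
  have m': "0 < 1 - m" "1 - m < 1" using m by auto
  note dE = elliptic_second_derivative[OF m] and dK = elliptic_first_derivative[OF m]
  have D: "((\<lambda>m. 1 - m) has_real_derivative - 1) (at m)"
    by (auto intro!: derivative_eq_intros)
  have dE': "((\<lambda>m. ?E (1 - m)) has_real_derivative
      - ((?E (1 - m) - ?K (1 - m)) / (p * (1 - m)))) (at m)"
    using DERIV_chain2[where g = "\<lambda>m. 1 - m", OF elliptic_second_derivative[OF m'] D] by simp
  have dK': "((\<lambda>m. ?K (1 - m)) has_real_derivative
      - ((?E (1 - m) - m * ?K (1 - m)) / (p * (1 - m) * m))) (at m)"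
    using DERIV_chain2[where g = "\<lambda>m. 1 - m", OF elliptic_first_derivative[OF m'] D] by simp
  \<comment> \<open>The left-hand side is the output of the product rule; here \<open>E'\<close> and
    \<open>K'\<close> stand for the values at \<open>1 - m\<close>. Over the common denominator
    \<open>p * m * (1 - m)\<close> all terms cancel.\<close>
  have alg: "(- ((E' - m * K') / (p * (1 - m) * m))) * E + (E - K) / (p * m) * K'
      + ((E - (1 - m) * K) / (p * m * (1 - m)) * E' + - ((E' - K') / (p * (1 - m))) * K)
      - ((E - (1 - m) * K) / (p * m * (1 - m)) * K' + - ((E' - m * K') / (p * (1 - m) * m)) * K)
      = 0" for E K E' K' :: real
  proof -
    define q where "q = 1 / (p * m * (1 - m))"
    have *: "x / (p * (1 - m) * m) = x * q" "x / (p * m * (1 - m)) = x * q"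
      "x / (p * (1 - m)) = x * m * q" "x / (p * m) = x * (1 - m) * q" for x
      using m p by (simp_all add: q_def field_simps)
    show ?thesis unfolding * by (simp add: algebra_simps)
  qed
  show ?thesis
    unfolding legendre_def[abs_def]
    using DERIV_diff[OF DERIV_add[OF DERIV_mult[OF dK' dE] DERIV_mult[OF dK dE']]
        DERIV_mult[OF dK dK']]
    by (simp only: alg)
qed

lemma legendre_constant:
  assumes "0 < x" "x < 1" "0 < y" "y < 1"
  shows "legendre x = legendre y"
proof -
  obtain c where c: "\<And>m. m \<in> {0<..<1} \<Longrightarrow> legendre m = c"
    using has_field_derivative_zero_constant[of "{0<..<1}" legendre]
      has_field_derivative_at_within[OF legendre_has_derivative_0]
    by (metis convex_real_interval(8) greaterThanLessThan_iff)
  show ?thesis using c[of x] c[of y] assms by simp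
qed

text \<open>Regrouping gives \<open>legendre m = K(m) E(1 - m) - K(1 - m) (K(m) - E(m))\<close>. The
  first product tends to \<open>pi_p p / 2\<close>, and the second, where an unbounded factor may
  meet a vanishing one, tends to 0.\<close>

lemma legendre_tendsto: "(legendre \<longlongrightarrow> pi_p p / 2) (at_right 0)"
proof -
  let ?K = "elliptic (1 / p - 1)" and ?E = "elliptic (1 / p)" and ?h = "pi_p p / 2"
  have ev: "eventually (\<lambda>m::real. 0 < m \<and> m < 1 / 2) (at_right 0)"
    using eventually_at_right_real[of 0 "1 / 2"] by simp
  have E0: "(?E \<longlongrightarrow> ?h) (at_right 0)"
    using continuous_on_elliptic_second
    by (simp add: continuous_on_Icc_at_rightD elliptic_0[symmetric, of "1 / p"])
  have "(?E \<longlongrightarrow> 1) (at_left 1)"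
    using continuous_on_Icc_at_leftD[OF continuous_on_elliptic_second]
    by (simp add: elliptic_second_1)
  then have E1: "((\<lambda>m. ?E (1 - m)) \<longlongrightarrow> 1) (at_right 0)"
    by (rule filterlim_compose) (auto intro!: filterlim_at_withinI tendsto_eq_intros
        simp: eventually_at_right_less eventually_at_filter)
  \<comment> \<open>A bound for K on \<open>0 < m < 1 / 2\<close>: there \<open>1 - m\<close>
    exceeds \<open>1 / 2\<close> and the exponent is negative. The cut-off \<open>1 / 2\<close> only
    keeps \<open>m\<close> away from 1.\<close>
  define B where "B = ?h * (1 / 2) powr (1 / p - 1)"
  have KB: "0 \<le> ?K m" "?K m \<le> B" if "0 < m" "m < 1 / 2" for m
  proof -
    show "0 \<le> ?K m" using elliptic_first_bounds(1)[of m] that by simp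
    have "?K m \<le> ?h * (1 - m) powr (1 / p - 1)"
      using elliptic_first_bounds(2)[of m] that by simp
    also have "\<dots> \<le> B"
      unfolding B_def using that p pi_p_pos by (intro mult_left_mono powr_mono2') auto
    finally show "?K m \<le> B" .
  qed
  have diff: "((\<lambda>m. ?K m - ?E m) \<longlongrightarrow> 0) (at_right 0)"
  proof (rule tendsto_sandwich[of "\<lambda>_. 0" _ _ "\<lambda>m. m * B"])
    show "\<forall>\<^sub>F m in at_right 0. ?K m - ?E m \<le> m * B"
      using ev
    proof eventually_elim
      case (elim m)
      then have "?K m - ?E m \<le> m * ?K m" using elliptic_diff_bounds(2)[of m] by simp
      also have "\<dots> \<le> m * B" using elim KB by (intro mult_left_mono) auto
      finally show ?case .
    qed
    show "\<forall>\<^sub>F m in at_right 0. 0 \<le> ?K m - ?E m"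
      using ev by eventually_elim (simp add: elliptic_diff_bounds(1))
  qed (auto intro!: tendsto_eq_intros)
  \<comment> \<open>The limit of K at 0 is inherited from that of E, as their difference
    vanishes.\<close>
  have K0: "(?K \<longlongrightarrow> ?h) (at_right 0)"
    using tendsto_add[OF diff E0] by simp
  \<comment> \<open>The rates \<open>m powr (1 / p - 1)\<close> for \<open>?K (1 - m)\<close> and
    \<open>m\<close> for the difference multiply to \<open>m powr (1 / p)\<close>, which tends to
    0.\<close>
  have prod: "((\<lambda>m. ?K (1 - m) * (?K m - ?E m)) \<longlongrightarrow> 0) (at_right 0)"
  proof (rule tendsto_sandwich[of "\<lambda>_. 0" _ _ "\<lambda>m. ?h * B * m powr (1 / p)"])
    show "\<forall>\<^sub>F m in at_right 0. ?K (1 - m) * (?K m - ?E m) \<le> ?h * B * m powr (1 / p)"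
      using ev
    proof eventually_elim
      case (elim m)
      then have "?K m - ?E m \<le> m * ?K m" using elliptic_diff_bounds(2)[of m] by simp
      also have "\<dots> \<le> m * B" using elim KB by (intro mult_left_mono) auto
      finally have "?K (1 - m) * (?K m - ?E m) \<le> (?h * m powr (1 / p - 1)) * (m * B)"
        using elim elliptic_first_bounds[of "1 - m"] elliptic_diff_bounds(1)[of m] pi_p_pos
        by (intro mult_mono) auto
      also have "\<dots> = ?h * B * m powr (1 / p)"
        using powr_mult_base[of m "1 / p - 1"] elim by (simp add: ac_simps)
      finally show ?case .
    qed
    show "\<forall>\<^sub>F m in at_right 0. 0 \<le> ?K (1 - m) * (?K m - ?E m)"
      using ev by eventually_elim (simp add: elliptic_diff_bounds(1) elliptic_first_bounds(1))
    have "((\<lambda>m. m powr (1 / p)) \<longlongrightarrow> 0) (at_right (0::real))"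
      using p tendsto_powr2[of "\<lambda>m. m" 0 "at_right 0" "\<lambda>_. 1 / p" "1 / p"]
      by (simp add: eventually_at_filter)
    then show "((\<lambda>m. ?h * B * m powr (1 / p)) \<longlongrightarrow> 0) (at_right 0)"
      by (rule tendsto_mult_right_zero)
  qed simp
  have "((\<lambda>m. ?K m * ?E (1 - m) - ?K (1 - m) * (?K m - ?E m)) \<longlongrightarrow> ?h * 1 - 0) (at_right 0)"
    by (intro tendsto_intros K0 E1 prod)
  then show ?thesis
    by (simp add: legendre_def[abs_def] algebra_simps)
qed

lemma legendre_eq:
  assumes "0 < m" "m < 1"
  shows "legendre m = pi_p p / 2"
proof -
  have "\<forall>\<^sub>F x in at_right 0. legendre x = legendre m"
    using eventually_at_right_real[OF zero_less_one]
    by (rule eventually_mono) (use assms in \<open>auto intro: legendre_constant\<close>)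
  then have "(legendre \<longlongrightarrow> legendre m) (at_right 0)"
    by (rule tendsto_eventually)
  then show ?thesis
    using legendre_tendsto tendsto_unique trivial_limit_at_right_real by blast
qed

end

theorem theorem1p1:
  fixes p k :: real
  assumes "1 < p" and "0 < k" and "k < 1"
  shows "K_p' p k * E_p p k + K_p p k * E_p' p k - K_p p k * K_p' p k = pi_p p / 2"
proof -
  have "0 < k powr p" "k powr p < 1"
    using assms powr_less_one[of p k] by auto
  \<comment> \<open>Passing to the complementary modulus is the reflection of \<open>m\<close> to
    \<open>1 - m\<close>, which matches the definition of \<open>legendre\<close>.\<close>
  moreover from this have "compl_modulus p k powr p = 1 - k powr p"
    using assms by (simp add: compl_modulus_def powr_powr)
  ultimately show ?thesis
    using legendre_eq[of p "k powr p"] assms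
    by (simp add: K_p'_def E_p'_def K_p_eq E_p_eq legendre_def)
qed

end
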